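(* Let $m\in\mathbb{N}_0$ be even and $a>0$. Then the function $$\Omega(x)=\frac{\beta^{(m)}(a)}{\beta^{(m)}(x+a)},\qquad x>0,$$ is increasing and logarithmically concave, and the inequality $$1<\frac{\beta^{(m)}(a)}{\beta^{(m)}(x+a)}$$ holds for all $x>0$.
   Context: Nielsen's $\beta$-function is the function $\beta:(0,\infty)\to\mathbb{R}$ defined by $\beta(x)=\int_0^1 \frac{t^{x-1}}{1+t}\,dt=\int_0^\infty\frac{e^{-xt}}{1+e^{-t}}\,dt$ for $x>0$. For $m\in\mathbb{N}_0=\{0,1,2,\dots\}$, $\beta^{(m)}$ denotes its $m$-th derivative, with $\beta^{(0)}=\beta$. A positive function is logarithmically concave if its logarithm is concave. *)

theory Defs
  imports "HOL-Analysis.Analysis"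
begin

(* Only the values at x > 0 are meaningful: the integral diverges for x <= 0.
   The integral is improper at t = 0 when x < 1; the Henstock-Kurzweil integral
   covers this case, and the value of the integrand at t = 0 is irrelevant. *)
definition nielsen_beta :: "real \<Rightarrow> real" where
  "nielsen_beta x = integral {0..1} (\<lambda>t. t powr (x - 1) / (1 + t))"

(* Since {0<..} is open, the values at x > 0 depend only on nielsen_beta on {0<..}. *)
definition nielsen_beta_deriv :: "nat \<Rightarrow> real \<Rightarrow> real" where
  "nielsen_beta_deriv m = (deriv ^^ m) nielsen_beta"

(* Positivity is part of the definition because ln is a total function on real. *)
definition log_concave_on :: "real set \<Rightarrow> (real \<Rightarrow> real) \<Rightarrow> bool" where
  "log_concave_on S f \<longleftrightarrow> (\<forall>x\<in>S. f x > 0) \<and> concave_on S (\<lambda>x. ln (f x))"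

end

theory Submission
  imports Defs
begin

text \<open>
  Expanding 1/(1+t) as \<Sum>k. t^(2k) (1-t) under the integral gives
  \<beta>(x) = \<Sum>k. 1/(x+2k) - 1/(x+2k+1), which is also half the difference of the digamma function
  at (x+1)/2 and x/2. The derivatives of the digamma function are the polygamma functions, whose
  series are the termwise derivatives; hence, for x > 0 and every m,

    (-1)^m \<beta>^(m)(x) / m! = \<Sum>k. g(x+2k)   where   g(x) = 1/x^(m+1) - 1/(x+1)^(m+1).

  The whole theorem is thereby reduced to two properties of the elementary function g, and
  both can be read off the factorization

    g(x) = 1/(x (x+1)) * (\<Sum>i\<le>m. 1/(x^i (x+1)^(m-i))).

  First, g is strictly decreasing, and so is (-1)^m \<beta>^(m). For even m this says that \<Omega> is
  increasing, and comparing \<beta>^(m) at a and at x+a gives \<Omega>(x) > 1.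
  Second, g is logarithmically convex: reciprocals of positive affine functions are, and
  logarithmic convexity survives products, sums and pointwise limits (sums are the interesting
  case, lemma \<open>log_convex_on_add\<close>). So (-1)^m \<beta>^(m) is logarithmically convex. For even m
  the logarithm of \<Omega>(x) is a constant minus that of \<beta>^(m)(x+a), hence concave.
\<close>


section \<open>Logarithmically convex functions\<close>

lemma convex_on_eq:
  assumes f: "convex_on S f" and eq: "\<And>x. x \<in> S \<Longrightarrow> f x = g x"
  shows "convex_on S g"
proof -
  have "convex S" using f by (rule convex_on_imp_convex)
  then have "g (u *\<^sub>R x + v *\<^sub>R y) = f (u *\<^sub>R x + v *\<^sub>R y)"
    if "x \<in> S" "y \<in> S" "u \<ge> 0" "v \<ge> 0" "u + v = 1" for x y u v
    using that by (intro eq[symmetric] convexD)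
  with f show ?thesis by (simp add: convex_on_def eq)
qed

definition log_convex_on :: "'a::real_vector set \<Rightarrow> ('a \<Rightarrow> real) \<Rightarrow> bool" where
  "log_convex_on S f \<longleftrightarrow> (\<forall>x\<in>S. f x > 0) \<and> convex_on S (\<lambda>x. ln (f x))"

lemma log_convex_on_pos: "log_convex_on S f \<Longrightarrow> x \<in> S \<Longrightarrow> f x > 0"
  by (simp add: log_convex_on_def)

lemma log_convex_on_cong:
  assumes "log_convex_on S f" "\<And>x. x \<in> S \<Longrightarrow> f x = g x"
  shows   "log_convex_on S g"
  using assms by (auto simp: log_convex_on_def elim!: convex_on_eq)

lemma log_convex_on_const: "convex S \<Longrightarrow> c > 0 \<Longrightarrow> log_convex_on S (\<lambda>_. c)"
  by (simp add: log_convex_on_def convex_on_def flip: distrib_right)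

lemma log_convex_on_mult:
  assumes f: "log_convex_on S f" and g: "log_convex_on S g"
  shows "log_convex_on S (\<lambda>x. f x * g x)"
proof -
  have "convex_on S (\<lambda>x. ln (f x) + ln (g x))"
    using f g by (intro convex_on_add) (auto simp: log_convex_on_def)
  then have "convex_on S (\<lambda>x. ln (f x * g x))"
    by (rule convex_on_eq)
       (use f g in \<open>auto simp: log_convex_on_def ln_mult\<close>)
  with f g show ?thesis by (simp add: log_convex_on_def)
qed

lemma log_convex_on_power:
  assumes "log_convex_on S f"
  shows "log_convex_on S (\<lambda>x. f x ^ n)"
proof (induction n)
  case 0
  have "convex S" using assms by (simp add: log_convex_on_def convex_on_def)
  then show ?case by (simp add: log_convex_on_const)
next
  case (Suc n)
  then show ?case using log_convex_on_mult[OF assms Suc] by simp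
qed

text \<open>
  A two-term instance of Hoelder's inequality. With F = f + g, write
  f(x)^u f(y)^v = F(x)^u F(y)^v * (f(x)/F(x))^u (f(y)/F(y))^v and bound the last two factors by the
  weighted arithmetic-geometric mean inequality (convexity of exp), and likewise for g; the
  fractions f/F and g/F add up to 1.
\<close>
lemma log_convex_on_add:
  assumes f: "log_convex_on S f" and g: "log_convex_on S g"
  shows "log_convex_on S (\<lambda>x. f x + g x)"
proof -
  define F where "F = (\<lambda>x. f x + g x)"
  have "ln (F (u *\<^sub>R x + v *\<^sub>R y)) \<le> u * ln (F x) + v * ln (F y)"
    if xy: "x \<in> S" "y \<in> S" and uv: "u \<ge> 0" "v \<ge> 0" "u + v = 1" for x y u v
  proof -
    define z where "z = u *\<^sub>R x + v *\<^sub>R y"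
    have "z \<in> S"
      using f xy uv by (auto simp: z_def log_convex_on_def convex_on_def intro: convexD)
    define P where "P = exp (u * ln (F x) + v * ln (F y))"
    have Fpos: "F x > 0" "F y > 0" "F z > 0"
      using xy \<open>z \<in> S\<close> f g by (auto simp: F_def log_convex_on_def intro!: add_pos_pos)
    have share: "h z \<le> P * (u * (h x / F x) + v * (h y / F y))" if h: "log_convex_on S h" for h
    proof -
      have pos: "h x > 0" "h y > 0" "h z > 0"
        using h xy \<open>z \<in> S\<close> by (auto simp: log_convex_on_def)
      have "ln (h z) \<le> u * ln (h x) + v * ln (h y)"
        using h xy uv unfolding z_def by (auto simp: log_convex_on_def convex_on_def)
      then have "h z \<le> exp (u * ln (h x) + v * ln (h y))"
        using pos by (metis exp_le_cancel_iff exp_ln)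
      also have "\<dots> = P * exp (u * ln (h x / F x) + v * ln (h y / F y))"
        using pos Fpos by (simp add: P_def ln_div algebra_simps flip: exp_add)
      also have "\<dots> \<le> P * (u * exp (ln (h x / F x)) + v * exp (ln (h y / F y)))"
        using exp_convex uv unfolding convex_on_def P_def by (intro mult_left_mono) auto
      finally show ?thesis using pos Fpos by simp
    qed
    have "F z \<le> P * (u * (f x / F x) + v * (f y / F y)) + P * (u * (g x / F x) + v * (g y / F y))"
      using share[OF f] share[OF g] by (simp add: F_def)
    also have "\<dots> = P * (u * ((f x + g x) / F x) + v * ((f y + g y) / F y))"
      by (simp add: add_divide_distrib algebra_simps)
    also have "\<dots> = P"
      using Fpos uv by (simp add: F_def)
    finally show ?thesis
      using Fpos unfolding P_def z_def by (metis ln_exp ln_le_cancel_iff exp_gt_zero)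
  qed
  moreover have "convex S" using f by (simp add: log_convex_on_def convex_on_def)
  ultimately show ?thesis
    using f g by (auto simp: log_convex_on_def convex_on_def F_def intro: add_pos_pos)
qed

lemma log_convex_on_sum_lessThan:
  fixes f :: "nat \<Rightarrow> 'a::real_vector \<Rightarrow> real"
  assumes "\<And>k. k < Suc n \<Longrightarrow> log_convex_on S (f k)"
  shows "log_convex_on S (\<lambda>x. \<Sum>k<Suc n. f k x)"
  using assms
proof (induction n)
  case 0
  then show ?case by simp
next
  case (Suc n)
  have "log_convex_on S (\<lambda>x. (\<Sum>k<Suc n. f k x) + f (Suc n) x)"
    by (intro log_convex_on_add Suc) auto
  then show ?case by (simp add: add_ac)
qed

lemma log_convex_on_sums:
  fixes f :: "nat \<Rightarrow> 'a::real_vector \<Rightarrow> real"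
  assumes f: "\<And>k. log_convex_on S (f k)"
    and F: "\<And>x. x \<in> S \<Longrightarrow> (\<lambda>k. f k x) sums F x"
  shows "log_convex_on S F"
proof -
  have "convex S" using f[of 0] by (simp add: log_convex_on_def convex_on_def)
  have pos: "F x > 0" if "x \<in> S" for x
    using suminf_pos[of "\<lambda>k. f k x"] F[OF that] f that by (auto simp: sums_iff log_convex_on_def)
  have lim: "(\<lambda>n. ln (\<Sum>k<Suc n. f k x)) \<longlonglongrightarrow> ln (F x)" if "x \<in> S" for x
  proof -
    have "(\<lambda>n. \<Sum>k<Suc n. f k x) \<longlonglongrightarrow> F x"
      using F[OF that] unfolding sums_def by (rule LIMSEQ_Suc)
    with pos[OF that] show ?thesis by (intro tendsto_ln) auto
  qed
  have "ln (F (u *\<^sub>R x + v *\<^sub>R y)) \<le> u * ln (F x) + v * ln (F y)"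
    if xy: "x \<in> S" "y \<in> S" and uv: "u \<ge> 0" "v \<ge> 0" "u + v = 1" for x y u v
  proof (rule LIMSEQ_le)
    show "(\<lambda>n. ln (\<Sum>k<Suc n. f k (u *\<^sub>R x + v *\<^sub>R y))) \<longlonglongrightarrow> ln (F (u *\<^sub>R x + v *\<^sub>R y))"
      using xy uv \<open>convex S\<close> by (intro lim) (auto intro: convexD)
    show "(\<lambda>n. u * ln (\<Sum>k<Suc n. f k x) + v * ln (\<Sum>k<Suc n. f k y))
            \<longlonglongrightarrow> u * ln (F x) + v * ln (F y)"
      using xy by (intro tendsto_intros lim)
    have "log_convex_on S (\<lambda>x. \<Sum>k<Suc n. f k x)" for n
      by (intro log_convex_on_sum_lessThan f)
    then have "ln (\<Sum>k<Suc n. f k (u *\<^sub>R x + v *\<^sub>R y))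
            \<le> u * ln (\<Sum>k<Suc n. f k x) + v * ln (\<Sum>k<Suc n. f k y)" for n
      using xy uv unfolding log_convex_on_def convex_on_def by blast
    then show "\<exists>N. \<forall>n\<ge>N. ln (\<Sum>k<Suc n. f k (u *\<^sub>R x + v *\<^sub>R y))
            \<le> u * ln (\<Sum>k<Suc n. f k x) + v * ln (\<Sum>k<Suc n. f k y)" by blast
  qed
  with pos \<open>convex S\<close> show ?thesis by (auto simp: log_convex_on_def convex_on_def)
qed

lemma log_convex_on_inverse_shift:
  fixes c :: real
  assumes "c \<ge> 0"
  shows "log_convex_on {0<..} (\<lambda>x. inverse (x + c))"
proof -
  have "- ln (u * x + v * y + c) \<le> u * - ln (x + c) + v * - ln (y + c)"
    if "x > 0" "y > 0" "u \<ge> 0" "v \<ge> 0" "u + v = 1" for x y u v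
  proof -
    have "u * (x + c) + v * (y + c) = u * x + v * y + (u + v) * c" by (simp add: algebra_simps)
    then have "u * x + v * y + c = u * (x + c) + v * (y + c)" using that by simp
    moreover have "u * ln (x + c) + v * ln (y + c) \<le> ln (u * (x + c) + v * (y + c))"
      using ln_concave that assms unfolding concave_on_iff by auto
    ultimately show ?thesis by simp
  qed
  then have "convex_on {0<..} (\<lambda>x. - ln (x + c))"
    unfolding convex_on_def by auto
  then have "convex_on {0<..} (\<lambda>x. ln (inverse (x + c)))"
    by (rule convex_on_eq) (use assms in \<open>auto simp: ln_inverse\<close>)
  with assms show ?thesis by (auto simp: log_convex_on_def)
qed


section \<open>Gaps between consecutive reciprocal powers\<close>

definition inverse_power_gap :: "nat \<Rightarrow> real \<Rightarrow> real" where
  "inverse_power_gap m x = inverse x ^ Suc m - inverse (x + 1) ^ Suc m"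

text \<open>
  The difference hides its sign, monotonicity and convexity; in this product of
  manifestly positive and decreasing factors all of them are visible.
\<close>
lemma inverse_power_gap_factor:
  assumes "x > 0"
  shows "inverse_power_gap m x =
           inverse x * inverse (x + 1) * (\<Sum>i<Suc m. inverse x ^ i * inverse (x + 1) ^ (m - i))"
proof -
  have "inverse x - inverse (x + 1) = inverse x * inverse (x + 1)"
    using assms by (simp add: field_simps)
  then show ?thesis
    unfolding inverse_power_gap_def diff_power_eq_sum by simp
qed

lemma inverse_power_gap_strict_antimono:
  assumes "0 < x" "x < y"
  shows "inverse_power_gap m y < inverse_power_gap m x"
proof -
  let ?S = "\<lambda>x::real. \<Sum>i<Suc m. inverse x ^ i * inverse (x + 1) ^ (m - i)"
  have inv: "inverse y < inverse x" "inverse (y + 1) < inverse (x + 1)"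
    using assms by auto
  have "inverse y * inverse (y + 1) < inverse x * inverse (x + 1)"
    using inv assms by (intro mult_strict_mono) auto
  moreover have "?S y \<le> ?S x"
    using inv assms by (intro sum_mono mult_mono power_mono) auto
  moreover have "?S y > 0"
    using assms by (intro sum_pos) auto
  ultimately show ?thesis
    using assms by (simp only: inverse_power_gap_factor) (intro mult_less_le_imp_less; simp)
qed

lemma log_convex_on_inverse_power_gap_shift:
  assumes "c \<ge> 0"
  shows "log_convex_on {0<..} (\<lambda>x. inverse_power_gap m (x + c))"
proof (rule log_convex_on_cong)
  have "log_convex_on {0<..} (\<lambda>x. inverse (x + c))"
       "log_convex_on {0<..} (\<lambda>x. inverse (x + c + 1))"
    using log_convex_on_inverse_shift[of c] log_convex_on_inverse_shift[of "c + 1"] assms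
    by (simp_all add: add.assoc)
  then show "log_convex_on {0<..} (\<lambda>x. inverse (x + c) * inverse (x + c + 1) *
          (\<Sum>i<Suc m. inverse (x + c) ^ i * inverse (x + c + 1) ^ (m - i)))"
    by (intro log_convex_on_mult log_convex_on_sum_lessThan log_convex_on_power)
qed (use assms in \<open>simp only: inverse_power_gap_factor add_pos_nonneg greaterThan_iff\<close>)


section \<open>Series for Nielsen's beta function and its derivatives\<close>

text \<open>
  The polygamma series at x/2 and (x+1)/2 run over the reciprocal powers of x/2 + k and
  x/2 + k + 1/2; after scaling by 2 they supply the terms with x + 2k and those with x + 2k + 1.
\<close>
lemma inverse_power_gap_sums_Polygamma:
  assumes "x > 0"
  shows "(\<lambda>k. inverse_power_gap m (x + 2 * real k)) sums
           ((-1) ^ m / fact m * ((Polygamma m ((x + 1) / 2) - Polygamma m (x / 2)) / 2 ^ Suc m))"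
proof -
  have half: "inverse (w + 2 * real k) ^ Suc m = inverse ((w / 2 + real k) ^ Suc m) / 2 ^ Suc m"
    for w k
  proof -
    have eq: "w + 2 * real k = 2 * (w / 2 + real k)" by simp
    show ?thesis
      unfolding eq
      by (simp only: power_inverse power_mult_distrib inverse_mult_distrib divide_inverse mult_ac)
  qed
  have gap: "inverse_power_gap m (x + 2 * real k) =
      (inverse ((x / 2 + real k) ^ Suc m) - inverse (((x + 1) / 2 + real k) ^ Suc m)) / 2 ^ Suc m"
    for k
    using half[of x k] half[of "x + 1" k] assms
    unfolding inverse_power_gap_def by (simp add: add_ac diff_divide_distrib)
  have "(\<lambda>k. inverse ((x / 2 + real k) ^ Suc m) - inverse (((x + 1) / 2 + real k) ^ Suc m)) sums
          ((-1) ^ m / fact m * (Polygamma m ((x + 1) / 2) - Polygamma m (x / 2)))"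
  proof (cases "m = 0")
    case True
    \<comment> \<open>Each reciprocal series diverges on its own; the digamma series regularizes
        both by the same terms, which cancel.\<close>
    have dig: "(\<lambda>k. inverse (real (Suc k)) - inverse (z + real k)) sums
                 (Digamma z + euler_mascheroni)" if "z > 0" for z :: real
      using summable_Digamma[of z] that by (simp add: Digamma_def summable_sums)
    show ?thesis
      using sums_diff[OF dig[of "(x + 1) / 2"] dig[of "x / 2"]] assms True by simp
  next
    case False
    have "(\<lambda>k. inverse ((z + real k) ^ Suc m)) sums ((-1) ^ Suc m * Polygamma m z / fact m)"
      if "z > 0" for z :: real
      using Polygamma_LIMSEQ[of z m] that False by simp
    from sums_diff[OF this[of "x / 2"] this[of "(x + 1) / 2"]] assms show ?thesis
      by (simp add: algebra_simps diff_divide_distrib)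
  qed
  from sums_divide[OF this, of "2 ^ Suc m"] show ?thesis
    by (simp add: gap)
qed

text \<open>
  Monotone convergence with the partial sums of \<Sum>k. t^(2k) (1-t) = 1/(1+t): grouping the
  alternating geometric series in pairs makes all terms nonnegative. At t = 1 the grouped series
  sums to 0 instead of 1/2, so the limit function is modified at that point.
\<close>
lemma nielsen_beta_eq_Digamma:
  assumes "x > 0"
  shows "nielsen_beta x = (Digamma ((x + 1) / 2) - Digamma (x / 2)) / 2" (is "_ = ?L")
proof -
  define f where "f k t = (t powr (x + 2 * real k - 1) - t powr (x + 2 * real k))" for k t
  define g where "g t = (if t = 1 then 0 else t powr (x - 1) / (1 + t))" for t :: real
  have f_int: "(f k has_integral inverse_power_gap 0 (x + 2 * real k)) {0..1}" for k
    using has_integral_diff[OF has_integral_powr_from_0[of "x + 2 * real k - 1" 1]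
        has_integral_powr_from_0[of "x + 2 * real k" 1]] assms
    unfolding f_def inverse_power_gap_def by (simp add: inverse_eq_divide)
  have f_eq: "f k t = t powr (x - 1) * (1 - t) * (t\<^sup>2) ^ k" if "t \<in> {0..1}" for k t
  proof (cases "t = 0")
    case False
    with that have "t > 0" by simp
    have "t powr (x + 2 * real k - 1) = t powr (x - 1) * (t\<^sup>2) ^ k"
         "t powr (x + 2 * real k) = t powr (x - 1) * t * (t\<^sup>2) ^ k"
    proof -
      have e: "t powr (2 * real k) = (t\<^sup>2) ^ k"
        using \<open>t > 0\<close> powr_realpow[of t "2 * k"] by (simp add: power_mult)
      have "x + 2 * real k - 1 = (x - 1) + 2 * real k" by simp
      then show "t powr (x + 2 * real k - 1) = t powr (x - 1) * (t\<^sup>2) ^ k"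
        by (simp only: powr_add e)
      have "x + 2 * real k = (x - 1) + 1 + 2 * real k" by simp
      then show "t powr (x + 2 * real k) = t powr (x - 1) * t * (t\<^sup>2) ^ k"
        using \<open>t > 0\<close> by (simp only: powr_add e powr_one)
    qed
    then show ?thesis by (simp add: f_def algebra_simps)
  qed (simp add: f_def)
  have f_sums: "(\<lambda>k. f k t) sums g t" if t: "t \<in> {0..1}" for t
  proof (cases "t = 1")
    case True
    then show ?thesis by (simp add: f_def g_def)
  next
    case False
    with t have "t\<^sup>2 < 1" by (simp add: abs_square_less_1)
    then have "(\<lambda>k. t powr (x - 1) * (1 - t) * (t\<^sup>2) ^ k) sums
                 (t powr (x - 1) * (1 - t) * (1 / (1 - t\<^sup>2)))"
      by (intro sums_mult geometric_sums) simp
    moreover have "(1 - t) * (1 / (1 - t\<^sup>2)) = 1 / (1 + t)"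
    proof -
      have "1 - t\<^sup>2 = (1 - t) * (1 + t)" by (simp add: power2_eq_square algebra_simps)
      with False show ?thesis by simp
    qed
    ultimately show ?thesis
      unfolding f_eq[OF t] using False by (simp only: g_def if_False mult.assoc) simp
  qed
  have "(g has_integral ?L) {0..1}"
  proof (rule has_integral_monotone_convergence_increasing)
    show "((\<lambda>t. \<Sum>k<n. f k t) has_integral (\<Sum>k<n. inverse_power_gap 0 (x + 2 * real k))) {0..1}"
      for n using f_int by (intro has_integral_sum) auto
    show "(\<Sum>k<n. f k t) \<le> (\<Sum>k<Suc n. f k t)" if "t \<in> {0..1}" for n t
      using that by (simp add: f_eq)
    show "(\<lambda>n. \<Sum>k<n. f k t) \<longlonglongrightarrow> g t" if "t \<in> {0..1}" for t
      using f_sums[OF that] by (simp add: sums_def)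
    show "(\<lambda>n. \<Sum>k<n. inverse_power_gap 0 (x + 2 * real k)) \<longlonglongrightarrow> ?L"
      using inverse_power_gap_sums_Polygamma[OF assms, of 0] by (simp add: sums_def)
  qed
  then have "((\<lambda>t. t powr (x - 1) / (1 + t)) has_integral ?L) {0..1}"
    by (rule has_integral_spike[of "{1}", rotated 2]) (auto simp: g_def)
  then show ?thesis
    unfolding nielsen_beta_def by (rule integral_unique)
qed

lemma nielsen_beta_deriv_eq_Polygamma:
  assumes "x > 0"
  shows "nielsen_beta_deriv m x = (Polygamma m ((x + 1) / 2) - Polygamma m (x / 2)) / 2 ^ Suc m"
  using assms
proof (induction m arbitrary: x)
  case 0
  then show ?case by (simp add: nielsen_beta_deriv_def nielsen_beta_eq_Digamma)
next
  case (Suc m)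
  let ?P = "\<lambda>m x. (Polygamma m ((x + 1) / 2) - Polygamma m (x / 2)) / 2 ^ Suc m :: real"
  have "(?P m has_real_derivative ?P (Suc m) x) (at x)"
    using Suc.prems
    by (auto intro!: derivative_eq_intros simp: nonpos_Ints_def field_simps)
  moreover have "eventually (\<lambda>y. nielsen_beta_deriv m y = ?P m y) (nhds x)"
    using eventually_nhds_in_open[of "{0<..}" x] Suc
    by (auto elim!: eventually_mono)
  ultimately have "(nielsen_beta_deriv m has_real_derivative ?P (Suc m) x) (at x)"
    by (subst DERIV_cong_ev[OF refl _ refl])
  then show ?case
    by (simp add: nielsen_beta_deriv_def DERIV_imp_deriv)
qed

lemma nielsen_beta_deriv_sums:
  assumes "x > 0"
  shows "(\<lambda>k. inverse_power_gap m (x + 2 * real k)) sums ((-1) ^ m / fact m * nielsen_beta_deriv m x)"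
  using inverse_power_gap_sums_Polygamma[OF assms] nielsen_beta_deriv_eq_Polygamma[OF assms] by simp


section \<open>Monotonicity and logarithmic convexity of the derivatives\<close>

lemma log_convex_on_nielsen_beta_deriv:
  "log_convex_on {0<..} (\<lambda>x. (-1) ^ m * nielsen_beta_deriv m x)"
proof -
  have "log_convex_on {0<..} (\<lambda>x. (-1) ^ m / fact m * nielsen_beta_deriv m x)"
    by (rule log_convex_on_sums[where f = "\<lambda>k x. inverse_power_gap m (x + 2 * real k)"])
       (simp_all only: log_convex_on_inverse_power_gap_shift nielsen_beta_deriv_sums
          greaterThan_iff of_nat_0_le_iff mult_nonneg_nonneg zero_le_numeral)
  from log_convex_on_mult[OF this log_convex_on_const[of _ "fact m"]] show ?thesis
    by simp
qed

lemma nielsen_beta_deriv_strict_antimono: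
  assumes "0 < x" "x < y"
  shows "(-1) ^ m * nielsen_beta_deriv m y < (-1) ^ m * nielsen_beta_deriv m x"
proof -
  let ?d = "\<lambda>k. inverse_power_gap m (x + 2 * real k) - inverse_power_gap m (y + 2 * real k)"
  have "?d sums ((-1) ^ m / fact m * nielsen_beta_deriv m x - (-1) ^ m / fact m * nielsen_beta_deriv m y)"
    using assms by (intro sums_diff nielsen_beta_deriv_sums) auto
  moreover have "?d k > 0" for k
    using assms by (simp add: inverse_power_gap_strict_antimono)
  ultimately have "0 < (-1) ^ m / fact m * nielsen_beta_deriv m x - (-1) ^ m / fact m * nielsen_beta_deriv m y"
    using suminf_pos[of ?d] by (simp add: sums_iff)
  then show ?thesis by (simp add: divide_less_cancel)
qed

theorem theorem2p15:
  fixes m :: nat and a :: real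
  assumes "even m" and "a > 0"
  shows "strict_mono_on {0<..} (\<lambda>x. nielsen_beta_deriv m a / nielsen_beta_deriv m (x + a))
       \<and> log_concave_on {0<..} (\<lambda>x. nielsen_beta_deriv m a / nielsen_beta_deriv m (x + a))
       \<and> (\<forall>x>0. 1 < nielsen_beta_deriv m a / nielsen_beta_deriv m (x + a))"
proof -
  let ?B = "nielsen_beta_deriv m"
  have lc: "log_convex_on {0<..} ?B"
    using log_convex_on_nielsen_beta_deriv[of m] assms by simp
  have pos: "?B x > 0" if "x > 0" for x
    using log_convex_on_pos[OF lc] that by simp
  have anti: "?B y < ?B x" if "0 < x" "x < y" for x y
    using nielsen_beta_deriv_strict_antimono[OF that, of m] assms by simp
  have "strict_mono_on {0<..} (\<lambda>x. ?B a / ?B (x + a))"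
    using assms pos anti by (auto intro!: strict_mono_onI divide_strict_left_mono)
  moreover have "log_concave_on {0<..} (\<lambda>x. ?B a / ?B (x + a))"
  proof -
    have shift: "ln (?B (u * x + v * y + a)) \<le> u * ln (?B (x + a)) + v * ln (?B (y + a))"
      and pos': "u * x + v * y > 0"
      if "x > 0" "y > 0" "u \<ge> 0" "v \<ge> 0" "u + v = 1" for x y u v
    proof -
      show "u * x + v * y > 0"
        using convexD[of "{0<..}" x y u v] that by simp
      have "u * (x + a) + v * (y + a) = u * x + v * y + (u + v) * a" by (simp add: algebra_simps)
      then have "u * x + v * y + a = u * (x + a) + v * (y + a)" using that by simp
      then show "ln (?B (u * x + v * y + a)) \<le> u * ln (?B (x + a)) + v * ln (?B (y + a))"
        using lc that assms unfolding log_convex_on_def convex_on_def by auto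
    qed
    have ln_ratio: "ln (?B a / ?B (x + a)) = ln (?B a) - ln (?B (x + a))" if "x > 0" for x
      using pos[of a] pos[of "x + a"] that assms by (simp add: ln_div)
    have "u * ln (?B a / ?B (x + a)) + v * ln (?B a / ?B (y + a)) \<le> ln (?B a / ?B (u * x + v * y + a))"
      if "x > 0" "y > 0" "u \<ge> 0" "v \<ge> 0" "u + v = 1" for x y u v
    proof -
      have "u * ln (?B a) + v * ln (?B a) = ln (?B a)"
        using that by (simp flip: distrib_right)
      then show ?thesis
        using shift[OF that] pos'[OF that] that by (simp add: ln_ratio right_diff_distrib)
    qed
    then have "concave_on {0<..} (\<lambda>x. ln (?B a / ?B (x + a)))"
      by (auto simp: concave_on_iff)
    then show ?thesis
      using pos assms by (auto simp: log_concave_on_def)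
  qed
  moreover have "1 < ?B a / ?B (x + a)" if "x > 0" for x
    using anti[of a "x + a"] pos[of "x + a"] that assms by simp
  ultimately show ?thesis by blast
qed

end
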